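(* Let $t_0>0$, $\alpha>0$, $0<\delta\le1$, $\sigma\ge0$, $\mu>0$, and $\beta(t)=\mu t^{\frac1\delta-1}$. Let $\epsilon:[t_0,+\infty)\to\mathcal H_1$ satisfy $\int_{t_0}^{+\infty}t^{1/2}\|\epsilon(t)\|\,dt<+\infty$. Let $(x(t),\lambda(t))$ be a global solution on $[t_0,+\infty)$ of $$\begin{cases}\ddot x(t)+\alpha\dot x(t)=-\beta(t)\big(\nabla f(x(t))+A^T(\lambda(t)+\delta t\dot\lambda(t))+\sigma A^T(Ax(t)-b)\big)+\epsilon(t),\\ \ddot\lambda(t)+\alpha\dot\lambda(t)=\beta(t)\big(A(x(t)+\delta t\dot x(t))-b\big),\end{cases}$$ and let $(x^*,\lambda^* )\in\Omega$. Then $$|f(x(t))-f(x^* )|=\mathcal O\Big(\frac1{t^{1/\delta}}\Big),\qquad \|Ax(t)-b\|=\mathcal O\Big(\frac1{t^{1/\delta}}\Big).$$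
   Context: $\mathcal H_1,\mathcal H_2$ are real Hilbert spaces, $A:\mathcal H_1\to\mathcal H_2$ is a continuous linear operator with adjoint $A^T$, $b\in\mathcal H_2$, and $f:\mathcal H_1\to\mathbb R$ is convex and continuously differentiable. $\Omega\subset\mathcal H_1\times\mathcal H_2$ is the set of saddle points of the Lagrangian $\mathcal L(x,\lambda)=f(x)+\langle\lambda,Ax-b\rangle$, equivalently the set of pairs $(x^*,\lambda^* )$ with $\nabla f(x^* )=-A^T\lambda^*$ and $Ax^*=b$; it is assumed nonempty. A global solution of the system is a pair $(x,\lambda)$ with $x\in\mathcal C^2([t_0,+\infty),\mathcal H_1)$, $\lambda\in\mathcal C^2([t_0,+\infty),\mathcal H_2)$, such that $(x,\lambda)$ and $(\dot x,\dot\lambda)$ are locally absolutely continuous and the system holds for almost every $t\ge t_0$. All $\mathcal O(\cdot)$ are as $t\to+\infty$. *)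

theory Defs
  imports "HOL-Analysis.Analysis" "HOL-Library.Landau_Symbols"
begin

definition lagrangian ::
  "('a::real_inner \<Rightarrow> real) \<Rightarrow> ('a \<Rightarrow> 'b::real_inner) \<Rightarrow> 'b \<Rightarrow> 'a \<Rightarrow> 'b \<Rightarrow> real"
  where "lagrangian f A b x lam = f x + lam \<bullet> (A x - b)"

definition saddle_points ::
  "('a::real_inner \<Rightarrow> real) \<Rightarrow> ('a \<Rightarrow> 'b::real_inner) \<Rightarrow> 'b \<Rightarrow> ('a \<times> 'b) set"
  where "saddle_points f A b =
    {(xs, ls). \<forall>x lam. lagrangian f A b xs lam \<le> lagrangian f A b xs ls \<and>
                       lagrangian f A b xs ls \<le> lagrangian f A b x ls}"

(* Derivative of a curve on the closed half-line; one-sided at the left endpoint t0.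
   Values of u to the left of t0 play no role. *)
definition deriv_from :: "real \<Rightarrow> (real \<Rightarrow> 'a::real_normed_vector) \<Rightarrow> real \<Rightarrow> 'a"
  where "deriv_from t0 u t = vector_derivative u (at t within {t0..})"

definition C2_from :: "real \<Rightarrow> (real \<Rightarrow> 'a::real_normed_vector) \<Rightarrow> bool"
  where "C2_from t0 u \<longleftrightarrow>
    u differentiable_on {t0..} \<and>
    deriv_from t0 u differentiable_on {t0..} \<and>
    continuous_on {t0..} (deriv_from t0 (deriv_from t0 u))"

definition abs_continuous_on_icc ::
  "real \<Rightarrow> real \<Rightarrow> (real \<Rightarrow> 'a::real_normed_vector) \<Rightarrow> bool"
  where "abs_continuous_on_icc a b u \<longleftrightarrow>
    (\<forall>e>0. \<exists>d>0. \<forall>(n::nat) (p::nat \<Rightarrow> real) (q::nat \<Rightarrow> real).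
       (\<forall>i<n. a \<le> p i \<and> p i \<le> q i \<and> q i \<le> b) \<and>
       disjoint_family_on (\<lambda>i. {p i<..<q i}) {..<n} \<and>
       (\<Sum>i<n. q i - p i) < d
       \<longrightarrow> (\<Sum>i<n. norm (u (q i) - u (p i))) < e)"

definition loc_abs_continuous_from :: "real \<Rightarrow> (real \<Rightarrow> 'a::real_normed_vector) \<Rightarrow> bool"
  where "loc_abs_continuous_from t0 u \<longleftrightarrow> (\<forall>T\<ge>t0. abs_continuous_on_icc t0 T u)"

(* The absolute continuity conjuncts already follow from C2_from. The library's adjoint is a
   choice operator; for bounded linear A the adjoint exists by the Riesz representation theorem,
   since the domain is complete. *)
definition global_solution ::
  "real \<Rightarrow> real \<Rightarrow> real \<Rightarrow> real \<Rightarrow> (real \<Rightarrow> real) \<Rightarrow>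
   ('a::{real_inner,complete_space} \<Rightarrow> 'a) \<Rightarrow> ('a \<Rightarrow> 'b::{real_inner,complete_space}) \<Rightarrow> 'b \<Rightarrow>
   (real \<Rightarrow> 'a) \<Rightarrow> (real \<Rightarrow> 'a) \<Rightarrow> (real \<Rightarrow> 'b) \<Rightarrow> bool"
  where "global_solution t0 \<alpha> \<delta> \<sigma> \<beta> gradf A b \<epsilon> x lam \<longleftrightarrow>
    C2_from t0 x \<and> C2_from t0 lam \<and>
    loc_abs_continuous_from t0 (\<lambda>t. (x t, lam t)) \<and>
    loc_abs_continuous_from t0 (\<lambda>t. (deriv_from t0 x t, deriv_from t0 lam t)) \<and>
    (AE t in lebesgue. t \<ge> t0 \<longrightarrow>
       deriv_from t0 (deriv_from t0 x) t + \<alpha> *\<^sub>R deriv_from t0 x t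
         = - (\<beta> t *\<^sub>R (gradf (x t)
                       + adjoint A (lam t + (\<delta> * t) *\<^sub>R deriv_from t0 lam t)
                       + \<sigma> *\<^sub>R adjoint A (A (x t) - b)))
           + \<epsilon> t \<and>
       deriv_from t0 (deriv_from t0 lam) t + \<alpha> *\<^sub>R deriv_from t0 lam t
         = \<beta> t *\<^sub>R (A (x t + (\<delta> * t) *\<^sub>R deriv_from t0 x t) - b))"

end

theory Submission
  imports Defs
begin

text \<open>The energy is the Lagrangian gap of \<open>x(t)\<close>, weighted by \<open>\<delta> t \<beta>(t)\<close>, plus the quadratic form
  \<open>\<langle>u, u'\<rangle> + \<alpha> / 2 \<parallel>u\<parallel>\<^sup>2 + \<delta> t / 2 \<parallel>u'\<parallel>\<^sup>2\<close> of both \<open>u = x - x\<^sup>*\<close> and \<open>u = \<lambda> - \<lambda>\<^sup>*\<close>. Its derivative is,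
  by convexity and for large \<open>t\<close>, at most \<open>\<langle>\<epsilon>, u + \<delta> t u'\<rangle>\<close> with \<open>u = x - x\<^sup>*\<close>, which is bounded by a multiple
  of \<open>sqrt t \<parallel>\<epsilon>\<parallel> sqrt E\<close>. Hence the energy is bounded and the gap decays like \<open>1 / (t \<beta>(t))\<close>. The
  second equation integrates exactly to \<open>\<lambda>' + \<alpha> \<lambda> - \<delta> t \<beta>(t) (A x - b) = const\<close>, so boundedness of \<open>\<lambda>\<close> and
  \<open>\<lambda>'\<close> gives the same rate for \<open>A x - b\<close>, hence for \<open>f(x) - f(x\<^sup>*)\<close>.\<close>

section \<open>Riesz representation and adjoints\<close>

text \<open>For small \<open>s\<close> of sign opposite to \<open>c\<close> the linear term would
  win. This turns minimality along a line into a vanishing first variation.\<close>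

lemma linear_le_quadratic_imp_zero:
  fixes c d :: real
  assumes "d \<ge> 0" "\<And>s. 0 \<le> c * s + d * s\<^sup>2"
  shows "c = 0"
proof (rule ccontr)
  assume "c \<noteq> 0"
  \<comment> \<open>With this choice the value is \<open>- (d + 1) * s\<^sup>2\<close>; the
    \<open>+ 1\<close> in the denominator covers \<open>d = 0\<close>.\<close>
  define s where "s = - c / (2 * d + 1)"
  have D: "2 * d + 1 > 0" using assms(1) by simp
  have s: "s * (2 * d + 1) = - c" using D by (simp add: s_def)
  then have "c * s + d * s\<^sup>2 = - (d + 1) * s\<^sup>2"
    by (simp add: power2_eq_square) algebra
  moreover have "s \<noteq> 0" using s \<open>c \<noteq> 0\<close> by auto
  then have "(d + 1) * s\<^sup>2 > 0" using assms(1) by simp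
  ultimately show False using assms(2)[of s] by (simp only: mult_minus_left)
qed

text \<open>The representing vector is the minimiser of \<open>x \<mapsto> \<parallel>x\<parallel>\<^sup>2 / 2 - \<phi> x\<close>; by the parallelogram
  law every minimising sequence is Cauchy.\<close>

lemma riesz_representation:
  fixes \<phi> :: "'a::{real_inner,complete_space} \<Rightarrow> real"
  assumes "bounded_linear \<phi>"
  shows "\<exists>z. \<forall>x. \<phi> x = x \<bullet> z"
proof -
  interpret bounded_linear \<phi> by fact
  obtain K where K: "\<And>x. norm (\<phi> x) \<le> norm x * K" using bounded by blast
  define J where "J x = (x \<bullet> x) / 2 - \<phi> x" for x
  have J_lower: "J x \<ge> - (K\<^sup>2 / 2)" for x
  proof -
    have "0 \<le> (norm x - K)\<^sup>2" by simp
    then show ?thesis using K[of x]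
      by (simp add: J_def power2_diff dot_square_norm algebra_simps abs_le_iff)
  qed
  define m where "m = (INF x. J x)"
  have bdd: "bdd_below (range J)" using J_lower by (auto intro!: bdd_belowI)
  have m_le: "m \<le> J x" for x unfolding m_def using bdd by (simp add: cINF_lower)
  have "\<exists>x. J x < m + 1 / Suc n" for n
    using cINF_less_iff[of UNIV J "m + 1 / Suc n"] bdd by (auto simp: m_def)
  then obtain X where X: "\<And>n. J (X n) < m + 1 / Suc n" by metis
  have para: "(norm (x - y))\<^sup>2 / 4 = J x + J y - 2 * J ((1/2) *\<^sub>R (x + y))" for x y
    by (simp add: J_def power2_norm_eq_inner inner_diff inner_add add scaleR inner_commute field_simps)
  \<comment> \<open>Both values exceed \<open>m\<close> only slightly, while the value at the
    midpoint is at least \<open>m\<close>.\<close>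
  have X_dist: "(norm (X i - X j))\<^sup>2 \<le> 4 * (1 / Suc i + 1 / Suc j)" for i j
  proof -
    have "(norm (X i - X j))\<^sup>2 / 4 \<le> (m + 1 / Suc i) + (m + 1 / Suc j) - 2 * m"
      unfolding para by (intro diff_mono add_mono mult_left_mono less_imp_le[OF X] m_le) simp
    then show ?thesis by argo
  qed
  have "Cauchy X"
  proof (rule metric_CauchyI)
    fix e :: real assume "e > 0"
    obtain N :: nat where N: "8 / e\<^sup>2 < N" using reals_Archimedean2 by blast
    show "\<exists>M. \<forall>i\<ge>M. \<forall>j\<ge>M. dist (X i) (X j) < e"
    proof (intro exI allI impI)
      fix i j assume ij: "N \<le> i" "N \<le> j"
      have "0 < 8 / e\<^sup>2" using \<open>e > 0\<close> by simp
      then have N0: "real N > 0" using N by linarith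
      have "1 / Suc i \<le> 1 / N" "1 / Suc j \<le> 1 / N" using ij N0 by (auto intro!: divide_left_mono)
      then have "(norm (X i - X j))\<^sup>2 \<le> 8 / N" using X_dist[of i j] by simp
      also have "\<dots> < e\<^sup>2" using N N0 \<open>e > 0\<close> by (simp add: field_simps)
      finally show "dist (X i) (X j) < e"
        using \<open>e > 0\<close> by (simp add: dist_norm power_less_imp_less_base)
    qed
  qed
  then obtain z where z: "X \<longlonglongrightarrow> z" using Cauchy_convergent convergent_def by blast
  have "(\<lambda>n. J (X n)) \<longlonglongrightarrow> J z" unfolding J_def by (intro tendsto_intros tendsto z) simp
  moreover have "(\<lambda>n. m + 1 / Suc n) \<longlonglongrightarrow> m + 0"
    using LIMSEQ_inverse_real_of_nat by (intro tendsto_intros) (simp add: inverse_eq_divide)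
  ultimately have "J z \<le> m + 0" by (rule LIMSEQ_le) (use X in \<open>auto intro: less_imp_le\<close>)
  then have z_min: "J z \<le> J x" for x using m_le[of x] by simp
  have "\<phi> h = h \<bullet> z" for h
  proof -
    \<comment> \<open>Expansion of \<open>J (z + s *\<^sub>R h) - J z\<close> in powers of
      \<open>s\<close>; minimality kills the linear coefficient.\<close>
    have "0 \<le> (z \<bullet> h - \<phi> h) * s + (h \<bullet> h / 2) * s\<^sup>2" for s
      using z_min[of "z + s *\<^sub>R h"]
      by (simp add: J_def inner_add add scaleR inner_commute power2_eq_square algebra_simps add_divide_distrib)
    then have "z \<bullet> h - \<phi> h = 0" by (intro linear_le_quadratic_imp_zero[of "h \<bullet> h / 2"]) auto
    then show ?thesis by (simp add: inner_commute)
  qed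
  then show ?thesis by blast
qed

text \<open>\<open>adjoint\<close> is defined by choice, so its defining identity holds once some
  adjoint exists. Riesz supplies one, representing the functional \<open>A x \<bullet> y\<close> of
  \<open>x\<close> for each \<open>y\<close>.\<close>

lemma adjoint_inner:
  fixes A :: "'a::{real_inner,complete_space} \<Rightarrow> 'b::real_inner"
  assumes "bounded_linear A"
  shows "A x \<bullet> y = x \<bullet> adjoint A y"
proof -
  have "\<exists>z. \<forall>x. A x \<bullet> y = x \<bullet> z" for y
    by (intro riesz_representation bounded_linear_compose[OF bounded_linear_inner_left assms])
  then have "\<exists>A'. \<forall>x y. A x \<bullet> y = x \<bullet> A' y" by metis
  then have "\<forall>x y. A x \<bullet> y = x \<bullet> adjoint A y" unfolding adjoint_def by (rule someI_ex)
  then show ?thesis by blast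
qed

text \<open>Linearity holds because a vector is determined by its inner products. The bound comes
  from applying Cauchy-Schwarz to \<open>A (adjoint A y) \<bullet> y\<close>, the squared norm of
  \<open>adjoint A y\<close>.\<close>

lemma bounded_linear_adjoint:
  fixes A :: "'a::{real_inner,complete_space} \<Rightarrow> 'b::real_inner"
  assumes "bounded_linear A"
  shows "bounded_linear (adjoint A)"
proof -
  note adj = adjoint_inner[OF assms, symmetric]
  obtain K where K: "\<And>x. norm (A x) \<le> norm x * K" "K > 0"
    using bounded_linear.pos_bounded[OF assms] by blast
  have "norm (adjoint A y) \<le> norm y * K" for y
  proof (cases "adjoint A y = 0")
    case False
    have "(norm (adjoint A y))\<^sup>2 = A (adjoint A y) \<bullet> y" by (simp add: power2_norm_eq_inner adj)
    also have "\<dots> \<le> norm (A (adjoint A y)) * norm y" by (rule norm_cauchy_schwarz)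
    also have "\<dots> \<le> (norm (adjoint A y) * K) * norm y" by (intro mult_right_mono K) simp
    finally show ?thesis using False by (simp add: power2_eq_square mult_ac)
  qed (use K in simp)
  then show ?thesis
    by (intro bounded_linear_intro[where K = K])
      (auto intro!: vector_eq_rdot[THEN iffD1] simp: adj inner_add_right vector_eq_ldot[symmetric])
qed

section \<open>Analytic tools\<close>

text \<open>Restriction to the line through \<open>y\<close> and \<open>z\<close> reduces this to
  the tangent inequality in one variable.\<close>

lemma convex_on_imp_above_gradient:
  fixes f :: "'a::real_inner \<Rightarrow> real"
  assumes "convex_on UNIV f" "GDERIV f y :> g"
  shows "f z \<ge> f y + g \<bullet> (z - y)"
proof -
  define h where "h s = f (y + s *\<^sub>R (z - y))" for s :: real
  have "convex_on UNIV h"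
  proof (rule convex_onI)
    fix t u v :: real assume "0 < t" "t < 1"
    have "y + ((1 - t) *\<^sub>R u + t *\<^sub>R v) *\<^sub>R (z - y)
        = (1 - t) *\<^sub>R (y + u *\<^sub>R (z - y)) + t *\<^sub>R (y + v *\<^sub>R (z - y))"
      by (simp add: algebra_simps)
    then show "h ((1 - t) *\<^sub>R u + t *\<^sub>R v) \<le> (1 - t) * h u + t * h v"
      unfolding h_def using convex_onD[OF assms(1), of t] \<open>0 < t\<close> \<open>t < 1\<close> by simp
  qed simp
  moreover have "(h has_real_derivative g \<bullet> (z - y)) (at 0)"
  proof -
    have "(f has_derivative (\<lambda>k. k \<bullet> g)) (at (y + 0 *\<^sub>R (z - y)))" using assms(2) by (simp add: gderiv_def)
    moreover have "((\<lambda>s. y + s *\<^sub>R (z - y)) has_derivative (\<lambda>s. s *\<^sub>R (z - y))) (at (0::real))"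
      by (auto intro!: derivative_eq_intros)
    ultimately have "(h has_derivative (\<lambda>s. (s *\<^sub>R (z - y)) \<bullet> g)) (at 0)"
      unfolding h_def by (rule has_derivative_compose[rotated])
    then show ?thesis by (simp add: has_field_derivative_def inner_commute mult_commute_abs)
  qed
  ultimately have "h 1 - h 0 \<ge> (g \<bullet> (z - y)) * (1 - 0)"
    by (intro convex_on_imp_above_tangent[where A = UNIV]) auto
  then show ?thesis by (simp add: h_def)
qed

lemma GDERIV_chain_vector_derivative:
  assumes "GDERIV f (u t) :> g" "(u has_vector_derivative u') (at t)"
  shows "((\<lambda>t. f (u t)) has_real_derivative g \<bullet> u') (at t)"
  using has_derivative_compose[OF assms(2)[unfolded has_vector_derivative_def] assms(1)[unfolded gderiv_def]]
  by (simp add: has_field_derivative_def inner_commute mult_commute_abs)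

text \<open>Continuous functions agree on a closed set, and a closed set of full measure in an open
  set contains it.\<close>

lemma AE_lebesgue_eq_imp_eq:
  fixes g h :: "real \<Rightarrow> 'a::{t2_space}"
  assumes "continuous_on {a..} g" "continuous_on {a..} h"
    and "AE t in lebesgue. t \<ge> a \<longrightarrow> g t = h t" and "t > a"
  shows "g t = h t"
proof -
  \<comment> \<open>Freezing the argument at \<open>a\<close> extends both functions continuously to
    the whole line.\<close>
  have "continuous_on UNIV (\<lambda>t. g (max a t))" "continuous_on UNIV (\<lambda>t. h (max a t))"
    by (auto intro!: continuous_on_compose2[OF assms(1)] continuous_on_compose2[OF assms(2)] continuous_intros)
  then have "closed {t. g (max a t) = h (max a t)}" by (rule closed_Collect_eq)
  moreover have "AE t \<in> {a<..} in lebesgue. t \<in> {t. g (max a t) = h (max a t)}"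
    using assms(3) by eventually_elim (auto simp: max_def)
  ultimately have "t \<in> {t. g (max a t) = h (max a t)}"
    using mem_closed_if_AE_lebesgue_open[OF open_greaterThan] \<open>t > a\<close> by (metis greaterThan_iff)
  then show ?thesis using \<open>t > a\<close> by (simp add: max_def)
qed

text \<open>Transfers the integral bound of the given perturbation to its continuous
  representative.\<close>

lemma integral_AE_le_integral:
  fixes g h :: "real \<Rightarrow> real"
  assumes "continuous_on {T..t} g" and "h absolutely_integrable_on {a..}" "a \<le> T"
    and "\<And>s. s \<ge> a \<Longrightarrow> h s \<ge> 0" and "AE s in lebesgue. s \<ge> a \<longrightarrow> g s = h s"
  shows "integral {T..t} g \<le> integral {a..} h"
proof -
  have "AE s in lebesgue. s \<in> {T..t} \<longrightarrow> g s = h s"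
    using assms(5) by eventually_elim (use assms(3) in auto)
  then obtain N where N: "N \<in> null_sets lebesgue" "{s. \<not> (s \<in> {T..t} \<longrightarrow> g s = h s)} \<subseteq> N"
    unfolding eventually_ae_filter by auto
  have h: "h integrable_on {a..}" using assms(2) absolutely_integrable_on_def by blast
  have sub: "{T..t} \<subseteq> {a..}" using assms(3) by auto
  have "integral {T..t} g = integral {T..t} h"
    by (rule integral_spike[where S = N]) (use N in \<open>auto simp: negligible_iff_null_sets\<close>)
  also have "\<dots> \<le> integral {a..} h"
    using h sub assms(4) by (intro integral_subset_le) (auto intro: integrable_on_subinterval)
  finally show ?thesis .
qed

text \<open>A Gronwall argument: \<open>E' \<le> k sqrt E\<close> makes \<open>sqrt (E + 1)\<close> grow at most like half the
  integral of \<open>k\<close>; adding \<open>1\<close> avoids the singularity of the square root at \<open>0\<close>.\<close>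

lemma gronwall_sqrt:
  fixes E E' k :: "real \<Rightarrow> real"
  assumes "\<And>t. t \<ge> T \<Longrightarrow> (E has_real_derivative E' t) (at t)"
    and E0: "\<And>t. t \<ge> T \<Longrightarrow> E t \<ge> 0"
    and le: "\<And>t. t \<ge> T \<Longrightarrow> E' t \<le> k t * sqrt (E t)"
    and k: "continuous_on {T..} k" "\<And>t. t \<ge> T \<Longrightarrow> k t \<ge> 0"
    and I: "\<And>t. t \<ge> T \<Longrightarrow> integral {T..t} k \<le> I"
    and "t \<ge> T"
  shows "E t \<le> (sqrt (E T + 1) + I / 2)\<^sup>2"
proof -
  define G where "G s = sqrt (E s + 1) - integral {T..s} k / 2" for s
  have kc: "continuous_on {T..t} k" using k(1) by (rule continuous_on_subset) auto
  have "G t \<le> G T"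
  proof (rule DERIV_nonpos_imp_decreasing_open[OF \<open>t \<ge> T\<close>])
    fix s assume s: "T < s" "s < t"
    then have E: "E s \<ge> 0" "(E has_real_derivative E' s) (at s)" using assms(1) E0 by auto
    have "((\<lambda>x. integral {T..x} k) has_real_derivative k s) (at s)"
      using integral_has_real_derivative[OF kc, of s] s by (simp add: at_within_Icc_at)
    then have "(G has_real_derivative E' s / (2 * sqrt (E s + 1)) - k s / 2) (at s)"
      unfolding G_def using E by (auto intro!: derivative_eq_intros simp: field_simps)
    moreover have "E' s \<le> k s * sqrt (E s + 1)"
      using le[of s] k(2)[of s] s E by (intro order_trans[OF le] mult_left_mono) auto
    then have "E' s / (2 * sqrt (E s + 1)) - k s / 2 \<le> 0" using E by (simp add: field_simps)
    ultimately show "\<exists>y. (G has_real_derivative y) (at s) \<and> y \<le> 0" by blast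
  next
    have "continuous_on {T..t} E" using assms(1)
      by (intro DERIV_atLeastAtMost_imp_continuous_on) (auto intro: has_field_derivative_at_within)
    then show "continuous_on {T..t} G" unfolding G_def
      by (intro continuous_intros indefinite_integral_continuous_1 integrable_continuous_real kc) auto
  qed
  then have "sqrt (E t + 1) \<le> sqrt (E T + 1) + I / 2"
    using I[OF \<open>t \<ge> T\<close>] by (simp add: G_def)
  then have "(sqrt (E t + 1))\<^sup>2 \<le> (sqrt (E T + 1) + I / 2)\<^sup>2"
    by (intro power_mono) (auto simp: E0 \<open>t \<ge> T\<close>)
  then show ?thesis using E0[OF \<open>t \<ge> T\<close>] by simp
qed

lemma has_vector_derivative_zero_imp_const:
  fixes g :: "real \<Rightarrow> 'a::real_normed_vector"
  assumes "\<And>s. s \<ge> T \<Longrightarrow> (g has_vector_derivative 0) (at s)" "t \<ge> T"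
  shows "g t = g T"
  using assms by (intro has_derivative_zero_unique[of "{T..}" g])
    (auto simp: has_vector_derivative_def intro: has_derivative_at_withinI)

section \<open>The energy of the primal-dual system\<close>

text \<open>With \<open>v = u'\<close> and \<open>s = \<delta> t\<close>, this is the
  exact-derivative part of \<open>(u'' + \<alpha> u') \<bullet> (u + \<delta> t u')\<close>; the
  rest is a multiple of \<open>v \<bullet> v\<close>.\<close>

definition kinetic_energy :: "real \<Rightarrow> real \<Rightarrow> 'a::real_inner \<Rightarrow> 'a \<Rightarrow> real"
  where "kinetic_energy \<alpha> s u v = u \<bullet> v + \<alpha> / 2 * (u \<bullet> u) + s / 2 * (v \<bullet> v)"

text \<open>In the factor of \<open>v t \<bullet> v t\<close>, the \<open>1\<close> comes from
  differentiating \<open>u \<bullet> v\<close>, \<open>\<delta> / 2\<close> from the weight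
  \<open>\<delta> t / 2\<close>, and \<open>\<alpha> * \<delta> * t\<close> from the
  damping.\<close>

lemma kinetic_energy_has_real_derivative:
  fixes u v :: "real \<Rightarrow> 'a::real_inner"
  assumes u: "(u has_vector_derivative v t) (at t)" and v: "(v has_vector_derivative w) (at t)"
  shows "((\<lambda>t. kinetic_energy \<alpha> (\<delta> * t) (u t) (v t)) has_real_derivative
     (w + \<alpha> *\<^sub>R v t) \<bullet> (u t + (\<delta> * t) *\<^sub>R v t) - (\<alpha> * \<delta> * t - 1 - \<delta> / 2) * (v t \<bullet> v t)) (at t)"
proof -
  note inner = bounded_bilinear.has_vector_derivative[OF bounded_bilinear_inner,
      folded has_real_derivative_iff_has_vector_derivative]
  show ?thesis unfolding kinetic_energy_def
    by (auto intro!: derivative_eq_intros inner[OF u v] inner[OF u u] inner[OF v v]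
        simp: inner_simps inner_commute algebra_simps)
qed

text \<open>Completing the square in \<open>(\<alpha> / 2) *\<^sub>R u + v\<close> absorbs the cross
  term into half of each square; \<open>s \<ge> 4 / \<alpha>\<close> makes half of the velocity
  square suffice.\<close>

lemma kinetic_energy_lower:
  assumes "\<alpha> > 0" "s \<ge> 4 / \<alpha>"
  shows "kinetic_energy \<alpha> s u v \<ge> \<alpha> / 4 * (norm u)\<^sup>2 + s / 4 * (norm v)\<^sup>2"
proof -
  have "0 \<le> ((\<alpha> / 2) *\<^sub>R u + v) \<bullet> ((\<alpha> / 2) *\<^sub>R u + v) / \<alpha>" using assms by simp
  then have "0 \<le> \<alpha> / 4 * (u \<bullet> u) + u \<bullet> v + 1 / \<alpha> * (v \<bullet> v)"
    using assms by (simp add: inner_simps inner_commute field_simps)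
  moreover have "1 / \<alpha> * (v \<bullet> v) \<le> s / 4 * (v \<bullet> v)"
    using assms by (intro mult_right_mono) (auto simp: field_simps)
  ultimately show ?thesis unfolding kinetic_energy_def power2_norm_eq_inner by argo
qed

lemma kinetic_energy_norm_le:
  assumes "\<alpha> > 0" "s \<ge> 4 / \<alpha>" "kinetic_energy \<alpha> s u v \<le> E"
  shows "norm u \<le> 2 / sqrt \<alpha> * sqrt E" "sqrt s * norm v \<le> 2 * sqrt E"
proof -
  have s: "s > 0" using assms by (meson divide_pos_pos less_le_trans zero_less_numeral)
  have K: "\<alpha> / 4 * (norm u)\<^sup>2 + s / 4 * (norm v)\<^sup>2 \<le> E"
    using kinetic_energy_lower[OF assms(1,2), of u v] assms(3) by simp
  have "\<alpha> / 4 * (norm u)\<^sup>2 \<ge> 0" "s / 4 * (norm v)\<^sup>2 \<ge> 0" using s assms(1) by auto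
  then have *: "\<alpha> / 4 * (norm u)\<^sup>2 \<le> E" "s / 4 * (norm v)\<^sup>2 \<le> E" using K by linarith+
  have "norm u = sqrt ((norm u)\<^sup>2)" by simp
  also have "\<dots> \<le> sqrt (2\<^sup>2 / \<alpha> * E)" using * assms(1) by (intro real_sqrt_le_mono) (simp add: field_simps)
  finally show "norm u \<le> 2 / sqrt \<alpha> * sqrt E" by (simp add: real_sqrt_mult real_sqrt_divide)
  have "sqrt s * norm v = sqrt (s * (norm v)\<^sup>2)" by (simp add: real_sqrt_mult)
  also have "\<dots> \<le> sqrt (2\<^sup>2 * E)" using * by (intro real_sqrt_le_mono) simp
  finally show "sqrt s * norm v \<le> 2 * sqrt E" by (simp add: real_sqrt_mult)
qed

text \<open>The trajectory from a time \<open>T\<close> on at which the damping dominates: \<open>T_large\<close> makes the energy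
  coercive and the dissipation term nonnegative.\<close>

locale primal_dual_trajectory =
  fixes f :: "'a::{real_inner,complete_space} \<Rightarrow> real" and gradf :: "'a \<Rightarrow> 'a"
    and A :: "'a \<Rightarrow> 'b::{real_inner,complete_space}" and b :: 'b
    and T \<alpha> \<delta> \<sigma> \<mu> I :: real and \<epsilon> x x' x'' :: "real \<Rightarrow> 'a" and lam lam' lam'' :: "real \<Rightarrow> 'b"
    and xs :: 'a and ls :: 'b
  assumes A: "bounded_linear A" and f: "convex_on UNIV f" and gradf: "\<And>y. GDERIV f y :> gradf y"
    and \<alpha>: "\<alpha> > 0" and \<delta>: "0 < \<delta>" "\<delta> \<le> 1" and \<sigma>: "\<sigma> \<ge> 0" and \<mu>: "\<mu> > 0"
    and T: "T \<ge> 1" and T_large: "\<delta> * T \<ge> 4 / \<alpha>" "\<alpha> * \<delta> * T \<ge> 1 + \<delta> / 2"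
    and x: "\<And>t. t \<ge> T \<Longrightarrow> (x has_vector_derivative x' t) (at t)"
      "\<And>t. t \<ge> T \<Longrightarrow> (x' has_vector_derivative x'' t) (at t)"
    and lam: "\<And>t. t \<ge> T \<Longrightarrow> (lam has_vector_derivative lam' t) (at t)"
      "\<And>t. t \<ge> T \<Longrightarrow> (lam' has_vector_derivative lam'' t) (at t)"
    and primal: "\<And>t. t \<ge> T \<Longrightarrow> x'' t + \<alpha> *\<^sub>R x' t =
      - ((\<mu> * t powr (1 / \<delta> - 1)) *\<^sub>R (gradf (x t) + adjoint A (lam t + (\<delta> * t) *\<^sub>R lam' t)
          + \<sigma> *\<^sub>R adjoint A (A (x t) - b))) + \<epsilon> t"
    and dual: "\<And>t. t \<ge> T \<Longrightarrow> lam'' t + \<alpha> *\<^sub>R lam' t =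
      (\<mu> * t powr (1 / \<delta> - 1)) *\<^sub>R (A (x t + (\<delta> * t) *\<^sub>R x' t) - b)"
    and \<epsilon>: "continuous_on {T..} \<epsilon>" "\<And>t. t \<ge> T \<Longrightarrow> integral {T..t} (\<lambda>s. s powr (1 / 2) * norm (\<epsilon> s)) \<le> I"
    and feasible: "A xs = b" and saddle: "\<And>y. f xs \<le> f y + ls \<bullet> (A y - b)"
begin

interpretation A: bounded_linear A by (rule A)
interpretation AT: bounded_linear "adjoint A" by (rule bounded_linear_adjoint[OF A])

text \<open>The gap of the augmented Lagrangian with penalty \<open>\<sigma>\<close> at the fixed
  multiplier \<open>ls\<close>; feasibility of \<open>xs\<close> reduces the subtracted value to
  \<open>f xs\<close>.\<close>

definition lagrangian_gap :: "'a \<Rightarrow> real"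
  where "lagrangian_gap y = f y - f xs + ls \<bullet> (A y - b) + \<sigma> / 2 * ((A y - b) \<bullet> (A y - b))"

definition energy :: "real \<Rightarrow> real"
  where "energy t = \<delta> * \<mu> * t powr (1 / \<delta>) * lagrangian_gap (x t)
    + kinetic_energy \<alpha> (\<delta> * t) (x t - xs) (x' t) + kinetic_energy \<alpha> (\<delta> * t) (lam t - ls) (lam' t)"

lemma f_gap_le_lagrangian_gap: "f y - f xs + ls \<bullet> (A y - b) \<le> lagrangian_gap y"
  using \<sigma> by (simp add: lagrangian_gap_def)

lemma lagrangian_gap_nonneg: "lagrangian_gap y \<ge> 0"
  using f_gap_le_lagrangian_gap[of y] saddle[of y] by simp

text \<open>Gradient inequality for the convex gap: the linear term is exact, and the penalty
  contributes twice its own value.\<close>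

lemma lagrangian_gap_le_grad:
  "lagrangian_gap y \<le> (gradf y + adjoint A ls + \<sigma> *\<^sub>R adjoint A (A y - b)) \<bullet> (y - xs)"
proof -
  have "f y - f xs \<le> gradf y \<bullet> (y - xs)"
    using convex_on_imp_above_gradient[OF f gradf, of y xs] by (simp add: inner_diff_right)
  moreover have "adjoint A z \<bullet> (y - xs) = z \<bullet> (A y - b)" for z
    using adjoint_inner[OF A, of "y - xs" z] by (simp add: A.diff feasible inner_commute)
  moreover have "\<sigma> / 2 * ((A y - b) \<bullet> (A y - b)) \<le> \<sigma> * ((A y - b) \<bullet> (A y - b))"
    using \<sigma> by (intro mult_right_mono) auto
  ultimately show ?thesis by (simp add: lagrangian_gap_def inner_add_left)
qed

section \<open>Differentiation of the energy along the trajectory\<close>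

lemma time_pos: "t \<ge> T \<Longrightarrow> t > 0"
  using T by linarith

lemma time_large:
  assumes "t \<ge> T"
  shows "\<delta> * t \<ge> 4 / \<alpha>" "\<alpha> * \<delta> * t - 1 - \<delta> / 2 \<ge> 0"
proof -
  have "\<delta> * T \<le> \<delta> * t" "\<alpha> * \<delta> * T \<le> \<alpha> * \<delta> * t" using assms \<alpha> \<delta> by (auto intro!: mult_left_mono)
  then show "\<delta> * t \<ge> 4 / \<alpha>" "\<alpha> * \<delta> * t - 1 - \<delta> / 2 \<ge> 0" using T_large by linarith+
qed

lemma residual_has_vector_derivative:
  assumes "t \<ge> T"
  shows "((\<lambda>t. A (x t) - b) has_vector_derivative A (x' t)) (at t)"
  using A.has_vector_derivative[OF x(1)[OF assms]] by (auto intro!: derivative_eq_intros)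

lemma lagrangian_gap_has_real_derivative:
  assumes "t \<ge> T"
  shows "((\<lambda>t. lagrangian_gap (x t)) has_real_derivative
    (gradf (x t) + adjoint A ls + \<sigma> *\<^sub>R adjoint A (A (x t) - b)) \<bullet> x' t) (at t)"
proof -
  note inner = bounded_bilinear.has_vector_derivative[OF bounded_bilinear_inner,
      folded has_real_derivative_iff_has_vector_derivative]
  note res = residual_has_vector_derivative[OF assms]
  note adj = adjoint_inner[OF A, of "x' t"]
  show ?thesis unfolding lagrangian_gap_def
    by (rule derivative_eq_intros refl GDERIV_chain_vector_derivative[OF gradf x(1)[OF assms]]
        inner[OF has_vector_derivative_const res] inner[OF res res])+
      (simp add: inner_add_left inner_add_right adj[symmetric] inner_commute)
qed

text \<open>The exponent of \<open>\<beta>\<close> is made for this: it solves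
  \<open>(\<delta> t \<beta>)' = \<beta>\<close>.\<close>

lemma weight_has_real_derivative:
  assumes "t \<ge> T"
  shows "((\<lambda>t. \<delta> * \<mu> * t powr (1 / \<delta>)) has_real_derivative \<mu> * t powr (1 / \<delta> - 1)) (at t)"
  using time_pos[OF assms] \<delta> by (auto intro!: derivative_eq_intros)

lemma weight_eq: "t \<ge> T \<Longrightarrow> \<delta> * \<mu> * t powr (1 / \<delta>) = \<mu> * t powr (1 / \<delta> - 1) * (\<delta> * t)"
  using time_pos[of t] by (simp add: powr_diff)

text \<open>Grouped by sign: the first summand is nonpositive by convexity, the last by damping, and
  only the perturbation can raise the energy.\<close>

definition energy_rate :: "real \<Rightarrow> real"
  where "energy_rate t = \<mu> * t powr (1 / \<delta> - 1) * (lagrangian_gap (x t)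
      - (gradf (x t) + adjoint A ls + \<sigma> *\<^sub>R adjoint A (A (x t) - b)) \<bullet> (x t - xs))
    + \<epsilon> t \<bullet> (x t - xs + (\<delta> * t) *\<^sub>R x' t)
    - (\<alpha> * \<delta> * t - 1 - \<delta> / 2) * (x' t \<bullet> x' t + lam' t \<bullet> lam' t)"

text \<open>The extrapolation by \<open>\<delta> t\<close> is tuned so that the coupling terms of the two equations cancel
  and the derivative of the weight \<open>\<delta> t \<beta>(t)\<close> is exactly \<open>\<beta>(t)\<close>.\<close>

lemma energy_has_real_derivative:
  assumes "t \<ge> T"
  shows "(energy has_real_derivative energy_rate t) (at t)"
proof -
  define B where "B = \<mu> * t powr (1 / \<delta> - 1)"
  define P where "P = gradf (x t) + adjoint A ls + \<sigma> *\<^sub>R adjoint A (A (x t) - b)"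
  define u where "u = x t - xs + (\<delta> * t) *\<^sub>R x' t"
  define v where "v = lam t - ls + (\<delta> * t) *\<^sub>R lam' t"
  have kx: "((\<lambda>t. kinetic_energy \<alpha> (\<delta> * t) (x t - xs) (x' t)) has_real_derivative
      (x'' t + \<alpha> *\<^sub>R x' t) \<bullet> u - (\<alpha> * \<delta> * t - 1 - \<delta> / 2) * (x' t \<bullet> x' t)) (at t)"
    unfolding u_def using x[OF assms]
    by (intro kinetic_energy_has_real_derivative) (auto intro!: derivative_eq_intros)
  have kl: "((\<lambda>t. kinetic_energy \<alpha> (\<delta> * t) (lam t - ls) (lam' t)) has_real_derivative
      (lam'' t + \<alpha> *\<^sub>R lam' t) \<bullet> v - (\<alpha> * \<delta> * t - 1 - \<delta> / 2) * (lam' t \<bullet> lam' t)) (at t)"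
    unfolding v_def using lam[OF assms]
    by (intro kinetic_energy_has_real_derivative) (auto intro!: derivative_eq_intros)
  \<comment> \<open>Splitting off \<open>ls\<close> completes \<open>P\<close> to the gradient of
    the gap and leaves the coupling \<open>adjoint A v\<close>.\<close>
  have "lam t + (\<delta> * t) *\<^sub>R lam' t = ls + v" by (simp add: v_def)
  then have "x'' t + \<alpha> *\<^sub>R x' t = \<epsilon> t - B *\<^sub>R P - B *\<^sub>R adjoint A v"
    by (simp add: primal[OF assms] B_def P_def AT.add algebra_simps)
  moreover have "A (x t + (\<delta> * t) *\<^sub>R x' t) - b = A u"
    by (simp add: u_def A.add A.diff feasible)
  then have "lam'' t + \<alpha> *\<^sub>R lam' t = B *\<^sub>R A u" by (simp add: dual[OF assms] B_def)
  moreover have "adjoint A v \<bullet> u = A u \<bullet> v"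
    using adjoint_inner[OF A, of u v] by (simp add: inner_commute)
  ultimately have sum: "(x'' t + \<alpha> *\<^sub>R x' t) \<bullet> u + (lam'' t + \<alpha> *\<^sub>R lam' t) \<bullet> v
      = \<epsilon> t \<bullet> u - B * (P \<bullet> u)"
    by (simp add: inner_diff_left)
  \<comment> \<open>Times \<open>B\<close>, the velocity part cancels against the derivative of the
    gap; the position part is left for convexity.\<close>
  have Pu: "P \<bullet> u = P \<bullet> (x t - xs) + \<delta> * t * (P \<bullet> x' t)" by (simp add: u_def inner_add_right)
  have "(energy has_real_derivative
      (B * lagrangian_gap (x t) + (P \<bullet> x' t) * (\<delta> * \<mu> * t powr (1 / \<delta>)))
      + ((x'' t + \<alpha> *\<^sub>R x' t) \<bullet> u - (\<alpha> * \<delta> * t - 1 - \<delta> / 2) * (x' t \<bullet> x' t))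
      + ((lam'' t + \<alpha> *\<^sub>R lam' t) \<bullet> v - (\<alpha> * \<delta> * t - 1 - \<delta> / 2) * (lam' t \<bullet> lam' t))) (at t)"
    unfolding energy_def[abs_def] B_def P_def
    by (intro DERIV_add DERIV_mult kx kl weight_has_real_derivative
        lagrangian_gap_has_real_derivative assms)
  also have "(B * lagrangian_gap (x t) + (P \<bullet> x' t) * (\<delta> * \<mu> * t powr (1 / \<delta>)))
      + ((x'' t + \<alpha> *\<^sub>R x' t) \<bullet> u - (\<alpha> * \<delta> * t - 1 - \<delta> / 2) * (x' t \<bullet> x' t))
      + ((lam'' t + \<alpha> *\<^sub>R lam' t) \<bullet> v - (\<alpha> * \<delta> * t - 1 - \<delta> / 2) * (lam' t \<bullet> lam' t)) = energy_rate t"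
    unfolding weight_eq[OF assms] energy_rate_def B_def[symmetric] P_def[symmetric] u_def[symmetric]
    using sum Pu by (simp add: algebra_simps)
  finally show ?thesis .
qed

section \<open>Boundedness of the energy\<close>

lemma energy_bounds:
  assumes "t \<ge> T"
  shows "\<delta> * \<mu> * t powr (1 / \<delta>) * lagrangian_gap (x t) \<le> energy t"
    and "kinetic_energy \<alpha> (\<delta> * t) (x t - xs) (x' t) \<le> energy t"
    and "kinetic_energy \<alpha> (\<delta> * t) (lam t - ls) (lam' t) \<le> energy t"
    and "energy t \<ge> 0"
proof -
  \<comment> \<open>The fresh type variable lets this serve both the primal and the dual
    space.\<close>
  have k: "kinetic_energy \<alpha> (\<delta> * t) u v \<ge> 0" for u v :: "'c::real_inner"
  proof -
    have "0 \<le> \<alpha> / 4 * (norm u)\<^sup>2 + \<delta> * t / 4 * (norm v)\<^sup>2"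
      using \<alpha> \<delta> time_pos[OF assms] by simp
    then show ?thesis using kinetic_energy_lower[OF \<alpha> time_large(1)[OF assms], of u v] by linarith
  qed
  have g: "\<delta> * \<mu> * t powr (1 / \<delta>) * lagrangian_gap (x t) \<ge> 0"
    using \<delta> \<mu> lagrangian_gap_nonneg by simp
  show "\<delta> * \<mu> * t powr (1 / \<delta>) * lagrangian_gap (x t) \<le> energy t"
    "kinetic_energy \<alpha> (\<delta> * t) (x t - xs) (x' t) \<le> energy t"
    "kinetic_energy \<alpha> (\<delta> * t) (lam t - ls) (lam' t) \<le> energy t" "energy t \<ge> 0"
    using g k[of "x t - xs" "x' t"] k[of "lam t - ls" "lam' t"] unfolding energy_def by linarith+
qed

text \<open>The energy controls \<open>sqrt (\<delta> * t) * norm (x' t)\<close>, so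
  \<open>\<delta> t x'\<close> may grow like \<open>sqrt t\<close>: hence the weight on
  \<open>\<epsilon>\<close>. The position term is brought to the same growth by
  \<open>t \<ge> 1\<close>.\<close>

lemma energy_rate_le:
  assumes "t \<ge> T"
  shows "energy_rate t \<le> (2 / sqrt \<alpha> + 2) * (t powr (1 / 2) * norm (\<epsilon> t)) * sqrt (energy t)"
proof -
  define S where "S = sqrt (energy t)"
  have S: "S \<ge> 0" using energy_bounds(4)[OF assms] by (simp add: S_def)
  have t: "t \<ge> 1" using T assms by linarith
  have "norm (x t - xs) \<le> 2 / sqrt \<alpha> * S"
    unfolding S_def by (rule kinetic_energy_norm_le(1)[OF \<alpha> time_large(1)[OF assms] energy_bounds(2)[OF assms]])
  also have "\<dots> \<le> (2 / sqrt \<alpha> * S) * sqrt t"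
    using mult_left_mono[of 1 "sqrt t" "2 / sqrt \<alpha> * S"] t S \<alpha> by simp
  finally have 1: "norm (x t - xs) \<le> 2 / sqrt \<alpha> * S * sqrt t" .
  have "norm ((\<delta> * t) *\<^sub>R x' t) = sqrt (\<delta> * t) * (sqrt (\<delta> * t) * norm (x' t))"
    using \<delta> t by (simp add: mult.assoc[symmetric])
  also have "\<dots> \<le> sqrt t * (2 * S)"
    unfolding S_def using \<delta> t energy_bounds(4)[OF assms]
    by (intro mult_mono kinetic_energy_norm_le(2)[OF \<alpha> time_large(1)[OF assms] energy_bounds(2)[OF assms]]
        real_sqrt_le_mono) (auto simp: mult_le_cancel_right1)
  finally have 2: "norm ((\<delta> * t) *\<^sub>R x' t) \<le> sqrt t * (2 * S)" .
  have "\<epsilon> t \<bullet> (x t - xs + (\<delta> * t) *\<^sub>R x' t) \<le> norm (\<epsilon> t) * norm (x t - xs + (\<delta> * t) *\<^sub>R x' t)"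
    by (rule norm_cauchy_schwarz)
  also have "\<dots> \<le> norm (\<epsilon> t) * (2 / sqrt \<alpha> * S * sqrt t + sqrt t * (2 * S))"
    using 1 2 by (intro mult_left_mono norm_triangle_le) auto
  also have "\<dots> = (2 / sqrt \<alpha> + 2) * (t powr (1 / 2) * norm (\<epsilon> t)) * S"
    using t by (simp add: powr_half_sqrt distrib_left distrib_right mult_ac)
  finally have 3: "\<epsilon> t \<bullet> (x t - xs + (\<delta> * t) *\<^sub>R x' t)
    \<le> (2 / sqrt \<alpha> + 2) * (t powr (1 / 2) * norm (\<epsilon> t)) * S" .
  have 4: "\<mu> * t powr (1 / \<delta> - 1) * (lagrangian_gap (x t)
      - (gradf (x t) + adjoint A ls + \<sigma> *\<^sub>R adjoint A (A (x t) - b)) \<bullet> (x t - xs)) \<le> 0"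
    using \<mu> lagrangian_gap_le_grad[of "x t"] by (intro mult_nonneg_nonpos) auto
  have 5: "(\<alpha> * \<delta> * t - 1 - \<delta> / 2) * (x' t \<bullet> x' t + lam' t \<bullet> lam' t) \<ge> 0"
    using time_large(2)[OF assms] by simp
  show ?thesis using 3 4 5 unfolding energy_rate_def S_def[symmetric] by linarith
qed

lemma energy_bounded: "\<exists>C. \<forall>t\<ge>T. energy t \<le> C"
proof -
  define c where "c = 2 / sqrt \<alpha> + 2"
  have c: "c \<ge> 0" using \<alpha> by (simp add: c_def)
  define k where "k t = c * (t powr (1 / 2) * norm (\<epsilon> t))" for t
  have "continuous_on {T..} k"
    unfolding k_def using \<epsilon>(1) T by (intro continuous_intros) auto
  moreover have "integral {T..t} k \<le> c * I" if "t \<ge> T" for t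
    unfolding k_def using \<epsilon>(2)[OF that] c by (simp add: mult_left_mono)
  ultimately have "energy t \<le> (sqrt (energy T + 1) + c * I / 2)\<^sup>2" if "t \<ge> T" for t
    using that c energy_has_real_derivative energy_bounds(4) energy_rate_le
    by (intro gronwall_sqrt[where k = k and E' = energy_rate]) (auto simp: k_def c_def)
  then show ?thesis by blast
qed

section \<open>Decay rates\<close>

lemma lagrangian_gap_decay: "\<exists>C. \<forall>t\<ge>T. t powr (1 / \<delta>) * lagrangian_gap (x t) \<le> C"
proof -
  obtain C where C: "\<And>t. t \<ge> T \<Longrightarrow> energy t \<le> C" using energy_bounded by blast
  have "t powr (1 / \<delta>) * lagrangian_gap (x t) \<le> C / (\<delta> * \<mu>)" if "t \<ge> T" for t
    using energy_bounds(1)[OF that] C[OF that] \<delta> \<mu> by (simp add: field_simps)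
  then show ?thesis by blast
qed

text \<open>The second equation says that \<open>\<lambda>' + \<alpha> \<lambda> - \<delta> t \<beta>(t) (A x - b)\<close> is a constant of motion.\<close>

lemma residual_decay: "\<exists>C. \<forall>t\<ge>T. t powr (1 / \<delta>) * norm (A (x t) - b) \<le> C"
proof -
  define q where "q t = lam' t + \<alpha> *\<^sub>R lam t - (\<delta> * \<mu> * t powr (1 / \<delta>)) *\<^sub>R (A (x t) - b)" for t
  have "(q has_vector_derivative 0) (at t)" if "t \<ge> T" for t
  proof -
    have "((\<lambda>t. (\<delta> * \<mu> * t powr (1 / \<delta>)) *\<^sub>R (A (x t) - b)) has_vector_derivative
        (\<delta> * \<mu> * t powr (1 / \<delta>)) *\<^sub>R A (x' t) + (\<mu> * t powr (1 / \<delta> - 1)) *\<^sub>R (A (x t) - b)) (at t)"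
      by (intro has_vector_derivative_scaleR weight_has_real_derivative residual_has_vector_derivative that)
    \<comment> \<open>The extrapolated residual is \<open>(A x - b) + \<delta> t A x'\<close>, so
      times \<open>\<beta>\<close> it is precisely this product rule.\<close>
    moreover have "(\<delta> * \<mu> * t powr (1 / \<delta>)) *\<^sub>R A (x' t) + (\<mu> * t powr (1 / \<delta> - 1)) *\<^sub>R (A (x t) - b)
        = lam'' t + \<alpha> *\<^sub>R lam' t"
      unfolding weight_eq[OF that] dual[OF that] by (simp add: A.add A.scaleR algebra_simps)
    moreover have "((\<lambda>t. lam' t + \<alpha> *\<^sub>R lam t) has_vector_derivative lam'' t + \<alpha> *\<^sub>R lam' t) (at t)"
      using lam[OF that] by (auto intro!: derivative_eq_intros)
    ultimately show ?thesis
      unfolding q_def using has_vector_derivative_diff by fastforce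
  qed
  then have q: "q t = q T" if "t \<ge> T" for t using that by (rule has_vector_derivative_zero_imp_const)
  obtain C where C: "\<And>t. t \<ge> T \<Longrightarrow> energy t \<le> C" using energy_bounded by blast
  define D where "D = 2 / sqrt (4 / \<alpha>) * sqrt C + \<alpha> * (2 / sqrt \<alpha> * sqrt C + norm ls) + norm (q T)"
  have "t powr (1 / \<delta>) * norm (A (x t) - b) \<le> D / (\<delta> * \<mu>)" if "t \<ge> T" for t
  proof -
    have k: "kinetic_energy \<alpha> (\<delta> * t) (lam t - ls) (lam' t) \<le> C"
      using energy_bounds(3) C that by (meson order_trans)
    note kin = kinetic_energy_norm_le[OF \<alpha> time_large(1)[OF that] k]
    \<comment> \<open>The lower bound on \<open>\<delta> * t\<close> turns the weighted velocity
      bound into a uniform one.\<close>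
    have "sqrt (4 / \<alpha>) * norm (lam' t) \<le> sqrt (\<delta> * t) * norm (lam' t)"
      by (intro mult_right_mono real_sqrt_le_mono time_large(1)[OF that]) simp
    then have "sqrt (4 / \<alpha>) * norm (lam' t) \<le> 2 * sqrt C" using kin(2) by linarith
    moreover have "sqrt (4 / \<alpha>) > 0" using \<alpha> by simp
    ultimately have 1: "norm (lam' t) \<le> 2 / sqrt (4 / \<alpha>) * sqrt C"
      by (metis mult.commute pos_le_divide_eq times_divide_eq_left)
    have "norm (lam t) \<le> norm (lam t - ls) + norm ls" by norm
    then have "norm (lam t) \<le> 2 / sqrt \<alpha> * sqrt C + norm ls" using kin(1) by linarith
    then have 2: "norm (\<alpha> *\<^sub>R lam t) \<le> \<alpha> * (2 / sqrt \<alpha> * sqrt C + norm ls)"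
      using \<alpha> by (simp del: distrib_left)
    have "(\<delta> * \<mu> * t powr (1 / \<delta>)) *\<^sub>R (A (x t) - b) = lam' t + \<alpha> *\<^sub>R lam t - q T"
      using q[OF that] by (simp add: q_def algebra_simps)
    then have "norm ((\<delta> * \<mu> * t powr (1 / \<delta>)) *\<^sub>R (A (x t) - b))
        \<le> norm (lam' t) + norm (\<alpha> *\<^sub>R lam t) + norm (q T)"
      by (metis add_right_mono norm_triangle_ineq norm_triangle_ineq4 order_trans)
    also have "\<dots> \<le> D" using 1 2 by (simp add: D_def)
    finally have "\<delta> * \<mu> * t powr (1 / \<delta>) * norm (A (x t) - b) \<le> D"
      unfolding norm_scaleR using \<delta> \<mu> by simp
    then show ?thesis using \<delta> \<mu> by (simp add: field_simps)
  qed
  then show ?thesis by blast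
qed

text \<open>By the saddle property, \<open>f y - f xs + ls \<bullet> (A y - b)\<close> lies between
  \<open>0\<close> and the gap, so the objective error is at most the gap plus a multiple of the
  residual.\<close>

lemma objective_decay: "\<exists>C. \<forall>t\<ge>T. t powr (1 / \<delta>) * \<bar>f (x t) - f xs\<bar> \<le> C"
proof -
  obtain C D where C: "\<And>t. t \<ge> T \<Longrightarrow> t powr (1 / \<delta>) * lagrangian_gap (x t) \<le> C"
    and D: "\<And>t. t \<ge> T \<Longrightarrow> t powr (1 / \<delta>) * norm (A (x t) - b) \<le> D"
    using lagrangian_gap_decay residual_decay by metis
  have "t powr (1 / \<delta>) * \<bar>f (x t) - f xs\<bar> \<le> C + norm ls * D" if "t \<ge> T" for t
  proof -
    have "\<bar>ls \<bullet> (A (x t) - b)\<bar> \<le> norm ls * norm (A (x t) - b)" by (rule Cauchy_Schwarz_ineq2)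
    then have "\<bar>f (x t) - f xs\<bar> \<le> lagrangian_gap (x t) + norm ls * norm (A (x t) - b)"
      using f_gap_le_lagrangian_gap[of "x t"] saddle[of "x t"] lagrangian_gap_nonneg[of "x t"] by linarith
    then have "t powr (1 / \<delta>) * \<bar>f (x t) - f xs\<bar>
        \<le> t powr (1 / \<delta>) * (lagrangian_gap (x t) + norm ls * norm (A (x t) - b))"
      by (rule mult_left_mono) simp
    also have "\<dots> = t powr (1 / \<delta>) * lagrangian_gap (x t) + norm ls * (t powr (1 / \<delta>) * norm (A (x t) - b))"
      by (simp add: algebra_simps)
    also have "\<dots> \<le> C + norm ls * D" using C[OF that] D[OF that] by (intro add_mono mult_left_mono) auto
    finally show ?thesis .
  qed
  then show ?thesis by blast
qed

end

section \<open>From the almost-everywhere system to the trajectory\<close>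

lemma saddle_pointD:
  fixes f :: "'a::real_inner \<Rightarrow> real" and A :: "'a \<Rightarrow> 'b::real_inner"
  assumes "(xs, ls) \<in> saddle_points f A b"
  shows "A xs = b" and "f xs \<le> f y + ls \<bullet> (A y - b)"
proof -
  have *: "lagrangian f A b xs l \<le> lagrangian f A b xs ls" "lagrangian f A b xs ls \<le> lagrangian f A b y ls" for l y
    using assms by (auto simp: saddle_points_def)
  \<comment> \<open>Moving the multiplier from \<open>ls\<close> by the residual itself would raise
    the Lagrangian by its squared norm.\<close>
  have "(A xs - b) \<bullet> (A xs - b) \<le> 0"
    using *(1)[of "ls + (A xs - b)"] by (simp add: lagrangian_def inner_add_left)
  then show "A xs = b" by (metis inner_gt_zero_iff not_less eq_iff_diff_eq_0)
  then show "f xs \<le> f y + ls \<bullet> (A y - b)" using *(2)[of y] by (simp add: lagrangian_def)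
qed

text \<open>Beyond \<open>t0\<close> the half-line is a neighbourhood of \<open>t\<close>, so the
  one-sided derivatives become two-sided.\<close>

lemma C2_from_derivs:
  assumes "C2_from t0 u"
  shows "continuous_on {t0..} u" "continuous_on {t0..} (deriv_from t0 u)"
    "continuous_on {t0..} (deriv_from t0 (deriv_from t0 u))"
    and "t > t0 \<Longrightarrow> (u has_vector_derivative deriv_from t0 u t) (at t)"
    and "t > t0 \<Longrightarrow> (deriv_from t0 u has_vector_derivative deriv_from t0 (deriv_from t0 u) t) (at t)"
proof -
  have d: "u differentiable_on {t0..}" "deriv_from t0 u differentiable_on {t0..}"
    using assms by (auto simp: C2_from_def)
  then show "continuous_on {t0..} u" "continuous_on {t0..} (deriv_from t0 u)"
    by (auto intro: differentiable_imp_continuous_on)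
  show "continuous_on {t0..} (deriv_from t0 (deriv_from t0 u))" using assms by (simp add: C2_from_def)
  have *: "(w has_vector_derivative deriv_from t0 w t) (at t)" if "w differentiable_on {t0..}" "t > t0"
    for w :: "real \<Rightarrow> 'a"
  proof -
    have "(w has_vector_derivative deriv_from t0 w t) (at t within {t0..})"
      unfolding deriv_from_def using that by (intro vector_derivative_works[THEN iffD1]) (auto simp: differentiable_on_def)
    moreover have "at t within {t0..} = at t" using \<open>t > t0\<close> by (intro at_within_interior) simp
    ultimately show ?thesis by simp
  qed
  show "t > t0 \<Longrightarrow> (u has_vector_derivative deriv_from t0 u t) (at t)"
    "t > t0 \<Longrightarrow> (deriv_from t0 u has_vector_derivative deriv_from t0 (deriv_from t0 u) t) (at t)"
    using * d by auto
qed

lemma bigo_inverse_powrI: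
  fixes h :: "real \<Rightarrow> real"
  assumes "\<And>t. t \<ge> T \<Longrightarrow> t powr p * \<bar>h t\<bar> \<le> C"
  shows "h \<in> O(\<lambda>t. 1 / t powr p)"
proof (rule bigoI)
  show "\<forall>\<^sub>F t in at_top. norm (h t) \<le> C * norm (1 / t powr p)"
    using eventually_ge_at_top[of T] eventually_gt_at_top[of 0]
    by eventually_elim (use assms in \<open>simp add: field_simps\<close>)
qed

theorem theorem2p4:
  fixes f :: "'a::{real_inner,complete_space} \<Rightarrow> real"
    and gradf :: "'a \<Rightarrow> 'a"
    and A :: "'a \<Rightarrow> 'b::{real_inner,complete_space}"
    and b :: 'b
    and t0 \<alpha> \<delta> \<sigma> \<mu> :: real
    and \<beta> :: "real \<Rightarrow> real"
    and \<epsilon> :: "real \<Rightarrow> 'a"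
    and x :: "real \<Rightarrow> 'a"
    and lam :: "real \<Rightarrow> 'b"
    and xstar :: 'a
    and lamstar :: 'b
  assumes "bounded_linear A"
    and "convex_on UNIV f"
    and "\<And>y. GDERIV f y :> gradf y"
    and "continuous_on UNIV gradf"
    and "t0 > 0" and "\<alpha> > 0" and "0 < \<delta>" and "\<delta> \<le> 1" and "\<sigma> \<ge> 0" and "\<mu> > 0"
    and "\<And>t. t \<ge> t0 \<Longrightarrow> \<beta> t = \<mu> * t powr (1 / \<delta> - 1)"
    and "(\<lambda>t. t powr (1 / 2) * norm (\<epsilon> t)) absolutely_integrable_on {t0..}"
    and "global_solution t0 \<alpha> \<delta> \<sigma> \<beta> gradf A b \<epsilon> x lam"
    and "(xstar, lamstar) \<in> saddle_points f A b"
  shows "(\<lambda>t. \<bar>f (x t) - f xstar\<bar>) \<in> O(\<lambda>t. 1 / t powr (1 / \<delta>)) \<and>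
         (\<lambda>t. norm (A (x t) - b)) \<in> O(\<lambda>t. 1 / t powr (1 / \<delta>))"
proof -
  interpret A: bounded_linear A by fact
  interpret AT: bounded_linear "adjoint A" by (rule bounded_linear_adjoint) fact
  note [simp] = \<open>\<alpha> > 0\<close> \<open>\<delta> > 0\<close>
  define x1 where "x1 = deriv_from t0 x"
  define x2 where "x2 = deriv_from t0 x1"
  define l1 where "l1 = deriv_from t0 lam"
  define l2 where "l2 = deriv_from t0 l1"
  define B where "B t = \<mu> * t powr (1 / \<delta> - 1)" for t
  define R where "R t = gradf (x t) + adjoint A (lam t + (\<delta> * t) *\<^sub>R l1 t)
    + \<sigma> *\<^sub>R adjoint A (A (x t) - b)" for t
  have C2: "C2_from t0 x" "C2_from t0 lam" using assms(13) by (auto simp: global_solution_def)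
  note xd = C2_from_derivs[OF C2(1), folded x1_def x2_def]
  note ld = C2_from_derivs[OF C2(2), folded l1_def l2_def]
  have ode: "AE t in lebesgue. t \<ge> t0 \<longrightarrow> x2 t + \<alpha> *\<^sub>R x1 t = - (B t *\<^sub>R R t) + \<epsilon> t \<and>
      l2 t + \<alpha> *\<^sub>R l1 t = B t *\<^sub>R (A (x t + (\<delta> * t) *\<^sub>R x1 t) - b)"
  proof -
    from assms(13) have "AE t in lebesgue. t \<ge> t0 \<longrightarrow> x2 t + \<alpha> *\<^sub>R x1 t = - (\<beta> t *\<^sub>R R t) + \<epsilon> t \<and>
        l2 t + \<alpha> *\<^sub>R l1 t = \<beta> t *\<^sub>R (A (x t + (\<delta> * t) *\<^sub>R x1 t) - b)"
      unfolding global_solution_def R_def x1_def l1_def x2_def l2_def by blast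
    then show ?thesis by eventually_elim (simp add: B_def assms(11))
  qed
  have B: "continuous_on {t0..} B" unfolding B_def using \<open>t0 > 0\<close> by (intro continuous_intros) auto
  have R: "continuous_on {t0..} R" unfolding R_def
    by (intro continuous_intros AT.continuous_on A.continuous_on xd ld
        continuous_on_compose2[OF assms(4)]) auto
  \<comment> \<open>This equation carries no perturbation: both sides are continuous, so it holds at
    every \<open>t > t0\<close>.\<close>
  have dual: "l2 t + \<alpha> *\<^sub>R l1 t = B t *\<^sub>R (A (x t + (\<delta> * t) *\<^sub>R x1 t) - b)" if "t > t0" for t
  proof (rule AE_lebesgue_eq_imp_eq[OF _ _ _ that])
    show "continuous_on {t0..} (\<lambda>t. l2 t + \<alpha> *\<^sub>R l1 t)" by (intro continuous_intros ld)
    show "continuous_on {t0..} (\<lambda>t. B t *\<^sub>R (A (x t + (\<delta> * t) *\<^sub>R x1 t) - b))"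
      by (intro continuous_intros A.continuous_on xd B)
    show "AE t in lebesgue. t \<ge> t0 \<longrightarrow> l2 t + \<alpha> *\<^sub>R l1 t = B t *\<^sub>R (A (x t + (\<delta> * t) *\<^sub>R x1 t) - b)"
      using ode by eventually_elim auto
  qed
  \<comment> \<open>A continuous representative of the perturbation, for which the equation holds everywhere.\<close>
  define e where "e t = x2 t + \<alpha> *\<^sub>R x1 t + B t *\<^sub>R R t" for t
  have e: "continuous_on {t0..} e" unfolding e_def by (intro continuous_intros xd B R)
  have e_AE: "AE t in lebesgue. t \<ge> t0 \<longrightarrow> t powr (1 / 2) * norm (e t) = t powr (1 / 2) * norm (\<epsilon> t)"
    using ode by eventually_elim (auto simp: e_def)
  \<comment> \<open>\<open>1\<close> gives \<open>sqrt t \<ge> 1\<close>, \<open>t0 + 1\<close>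
    keeps \<open>T\<close> off the endpoint, and the other two yield coercivity and nonnegative
    dissipation.\<close>
  define T where "T = max (max 1 (t0 + 1)) (max (4 / (\<alpha> * \<delta>)) ((1 + \<delta> / 2) / (\<alpha> * \<delta>)))"
  have T: "T \<ge> 1" "T > t0" "T \<ge> 4 / (\<alpha> * \<delta>)" "T \<ge> (1 + \<delta> / 2) / (\<alpha> * \<delta>)" by (auto simp: T_def)
  interpret primal_dual_trajectory f gradf A b T \<alpha> \<delta> \<sigma> \<mu>
    "integral {t0..} (\<lambda>t. t powr (1 / 2) * norm (\<epsilon> t))" e x x1 x2 lam l1 l2 xstar lamstar
  proof
    show "\<delta> * T \<ge> 4 / \<alpha>" "\<alpha> * \<delta> * T \<ge> 1 + \<delta> / 2"
      using T(3,4) by (auto simp: divide_le_eq mult_ac)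
    show "continuous_on {T..} e" using e by (rule continuous_on_subset) (use T in auto)
    show "integral {T..t} (\<lambda>s. s powr (1 / 2) * norm (e s))
        \<le> integral {t0..} (\<lambda>t. t powr (1 / 2) * norm (\<epsilon> t))" for t
    proof (rule integral_AE_le_integral[OF _ assms(12) _ _ e_AE])
      show "continuous_on {T..t} (\<lambda>s. s powr (1 / 2) * norm (e s))"
        using T \<open>t0 > 0\<close> by (intro continuous_intros continuous_on_subset[OF e]) auto
    qed (use T in auto)
    show "x2 t + \<alpha> *\<^sub>R x1 t = - ((\<mu> * t powr (1 / \<delta> - 1)) *\<^sub>R (gradf (x t)
        + adjoint A (lam t + (\<delta> * t) *\<^sub>R l1 t) + \<sigma> *\<^sub>R adjoint A (A (x t) - b))) + e t" for t
      by (simp add: e_def B_def R_def)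
    show "l2 t + \<alpha> *\<^sub>R l1 t = (\<mu> * t powr (1 / \<delta> - 1)) *\<^sub>R (A (x t + (\<delta> * t) *\<^sub>R x1 t) - b)"
      if "T \<le> t" for t using dual[of t] that T by (simp add: B_def)
  qed (use T assms xd ld saddle_pointD[OF assms(14)] in auto)
  show ?thesis using objective_decay residual_decay by (auto intro!: bigo_inverse_powrI)
qed

end
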